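(* In the setting of the context, for $k\in\{2,\dots,q\}$, $\mathfrak W^{(k)}$ is the orthogonal complement of $\mathfrak V^{(k-1)}$ in $\mathfrak V^{(k)}$ with respect to the scalar product $\langle\cdot,\cdot\rangle$; i.e., writing $\oplus$ for the $\langle\cdot,\cdot\rangle$-orthogonal direct sum and $\mathfrak W^{(q+1)}$ for the $\langle\cdot,\cdot\rangle$-orthogonal complement of $\mathfrak V^{(q)}$ in $\mathcal B$, $$\mathcal B=\mathfrak V^{(1)}\oplus\mathfrak W^{(2)}\oplus\cdots\oplus\mathfrak W^{(q)}\oplus\mathfrak W^{(q+1)}.$$ Furthermore, for $u\in\mathcal B$, $$u=u^{(1)}(u)+\big(u^{(2)}(u)-u^{(1)}(u)\big)+\cdots+\big(u^{(q)}(u)-u^{(q-1)}(u)\big)+\big(u-u^{(q)}(u)\big)$$ is the $\langle\cdot,\cdot\rangle$-orthogonal decomposition of $u$ corresponding to this direct sum.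
   Context: $(\mathcal B,\|\cdot\|)$ is a reflexive separable Banach space with dual $\mathcal B^*$ and dual pairing $[\cdot,\cdot]$, whose norm is quadratic: $\|u\|^2=[Q^{-1}u,u]$, where $Q:\mathcal B^*\to\mathcal B$ is a symmetric positive bijective linear operator. $\langle u,v\rangle:=[Q^{-1}u,v]$. Let $q\in\mathbb N^*\cup\{\infty\}$ and let $\mathcal I^{(q)}$ be an index tree of depth $q$, i.e. a finite set of $q$-tuples; for a tuple $i$ of length $\geq k$, $i^{(k)}:=(i_1,\dots,i_k)$, and $\mathcal I^{(k)}:=\{i^{(k)}:i\in\mathcal I^{(q)}\}$. For $k\in\{1,\dots,q-1\}$, $\pi^{(k,k+1)}$ is an $\mathcal I^{(k)}\times\mathcal I^{(k+1)}$ matrix of rank $|\mathcal I^{(k)}|$. $(\phi^{(q)}_i)_{i\in\mathcal I^{(q)}}$ are linearly independent elements of $\mathcal B^*$ and, for $k\in\{1,\dots,q-1\}$, $\phi^{(k)}_i=\sum_{j\in\mathcal I^{(k+1)}}\pi^{(k,k+1)}_{i,j}\phi^{(k+1)}_j$. Gamblets: for $i\in\mathcal I^{(k)}$, $\psi^{(k)}_i$ is the minimizer of $\|\psi\|$ over $\psi\in\mathcal B$ subject to $[\phi^{(k)}_j,\psi]=\delta_{i,j}$ for $j\in\mathcal I^{(k)}$. $\mathfrak V^{(k)}:=\operatorname{span}\{\psi^{(k)}_i:i\in\mathcal I^{(k)}\}$ and $u^{(k)}(u):=\sum_{i\in\mathcal I^{(k)}}[\phi^{(k)}_i,u]\psi^{(k)}_i$.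 For $k\in\{2,\dots,q\}$, $\mathcal J^{(k)}$ is a finite set of $k$-tuples with $\{j^{(k-1)}:j\in\mathcal J^{(k)}\}=\mathcal I^{(k-1)}$ and, for $i\in\mathcal I^{(k-1)}$, $\#\{j\in\mathcal J^{(k)}:j^{(k-1)}=i\}=\#\{t\in\mathcal I^{(k)}:t^{(k-1)}=i\}-1$. $W^{(k)}$ is a $\mathcal J^{(k)}\times\mathcal I^{(k)}$ matrix with $\operatorname{Im}(W^{(k),T})=\operatorname{Ker}(\pi^{(k-1,k)})$. $\chi^{(k)}_i:=\sum_{j\in\mathcal I^{(k)}}W^{(k)}_{i,j}\psi^{(k)}_j$ for $i\in\mathcal J^{(k)}$, and $\mathfrak W^{(k)}:=\operatorname{span}\{\chi^{(k)}_i:i\in\mathcal J^{(k)}\}$. When $q=\infty$, the ranges of $k$ are read as all finite levels, $\mathcal I^{(\infty)}$ is a set of infinite sequences with every $\mathcal I^{(k)}$ finite, $(\phi^{(k)}_i)_{i\in\mathcal I^{(k)}}$, $k\ge1$, are families in $\mathcal B^*$, linearly independent for each $k$, satisfying the nesting relation for every $k\ge1$; $\mathfrak V^{(\infty)}$ is the closure of $\bigcup_k\mathfrak V^{(k)}$, $u^{(\infty)}(u)=\lim_k u^{(k)}(u)$, and the sums are (Hilbert) infinite sums. *)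

theory Defs
  imports "HOL-Analysis.Analysis" "HOL-Library.Function_Algebras"
begin

definition reflexive_space :: "'b::banach itself \<Rightarrow> bool" where
  "reflexive_space _ \<longleftrightarrow>
     (\<forall>F :: ('b \<Rightarrow>\<^sub>L real) \<Rightarrow>\<^sub>L real. \<exists>u :: 'b. \<forall>\<phi>. blinfun_apply F \<phi> = blinfun_apply \<phi> u)"

text \<open>The dual of \<open>'b\<close> is \<open>'b \<Rightarrow>\<^sub>L real\<close>, and the pairing of \<open>\<phi>\<close> with \<open>u\<close> is \<open>blinfun_apply \<phi> u\<close>.\<close>

definition sym_pos_bijection :: "(('b::banach \<Rightarrow>\<^sub>L real) \<Rightarrow> 'b) \<Rightarrow> bool" where
  "sym_pos_bijection Q \<longleftrightarrow>
     linear Q \<and> bij Q \<and>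
     (\<forall>\<phi> \<phi>'. blinfun_apply \<phi> (Q \<phi>') = blinfun_apply \<phi>' (Q \<phi>)) \<and>
     (\<forall>\<phi>. 0 \<le> blinfun_apply \<phi> (Q \<phi>))"

definition scalar_prod :: "(('b::banach \<Rightarrow>\<^sub>L real) \<Rightarrow> 'b) \<Rightarrow> 'b \<Rightarrow> 'b \<Rightarrow> real" where
  "scalar_prod Q u v = blinfun_apply (inv Q u) v"

definition quadratic_norm :: "(('b::banach \<Rightarrow>\<^sub>L real) \<Rightarrow> 'b) \<Rightarrow> bool" where
  "quadratic_norm Q \<longleftrightarrow> (\<forall>u. (norm u)\<^sup>2 = blinfun_apply (inv Q u) u)"

definition lin_indep_family :: "('i \<Rightarrow> 'v::real_vector) \<Rightarrow> 'i set \<Rightarrow> bool" where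
  "lin_indep_family f A \<longleftrightarrow> inj_on f A \<and> independent (f ` A)"

text \<open>The scalar product is a parameter: it depends on \<open>Q\<close> and does not come from a
  \<open>real_inner\<close> instance of the space.\<close>

definition orth_complement_in :: "('b \<Rightarrow> 'b \<Rightarrow> real) \<Rightarrow> 'b set \<Rightarrow> 'b set \<Rightarrow> 'b set" where
  "orth_complement_in ip S V = {v \<in> V. \<forall>s\<in>S. ip s v = 0}"

definition decomposes_as ::
    "'k set \<Rightarrow> ('k \<Rightarrow> 'b::banach set) \<Rightarrow> 'b \<Rightarrow> ('k \<Rightarrow> 'b) \<Rightarrow> bool" where
  "decomposes_as K S u f \<longleftrightarrow> (\<forall>k\<in>K. f k \<in> S k) \<and> (f has_sum u) K"

text \<open>Orthogonal direct sum; for infinite \<open>K\<close> this is the Hilbert sum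
  (unconditionally convergent series), for finite \<open>K\<close> the algebraic one.\<close>

definition is_orth_direct_sum ::
    "('b \<Rightarrow> 'b \<Rightarrow> real) \<Rightarrow> 'k set \<Rightarrow> ('k \<Rightarrow> 'b::banach set) \<Rightarrow> 'b set \<Rightarrow> bool" where
  "is_orth_direct_sum ip K S T \<longleftrightarrow>
     (\<forall>k\<in>K. subspace (S k)) \<and>
     (\<forall>k\<in>K. \<forall>l\<in>K. k \<noteq> l \<longrightarrow> (\<forall>x\<in>S k. \<forall>y\<in>S l. ip x y = 0)) \<and>
     T = {u. \<exists>f. decomposes_as K S u f} \<and>
     (\<forall>u f g. decomposes_as K S u f \<longrightarrow> decomposes_as K S u g \<longrightarrow> (\<forall>k\<in>K. f k = g k))"

text \<open>A vector indexed by \<open>A\<close> is a function vanishing outside \<open>A\<close>. An \<open>R \<times> C\<close> matrix is a binary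
  function of which only the entries in \<open>R \<times> C\<close> are used.\<close>

definition vecs :: "'i set \<Rightarrow> ('i \<Rightarrow> real) set" where
  "vecs A = {x. \<forall>i. i \<notin> A \<longrightarrow> x i = 0}"

definition mat_mult_vec ::
    "'r set \<Rightarrow> 'c set \<Rightarrow> ('r \<Rightarrow> 'c \<Rightarrow> real) \<Rightarrow> ('c \<Rightarrow> real) \<Rightarrow> 'r \<Rightarrow> real" where
  "mat_mult_vec R C M x = (\<lambda>i. if i \<in> R then \<Sum>j\<in>C. M i j * x j else 0)"

definition mat_image :: "'r set \<Rightarrow> 'c set \<Rightarrow> ('r \<Rightarrow> 'c \<Rightarrow> real) \<Rightarrow> ('r \<Rightarrow> real) set" where
  "mat_image R C M = mat_mult_vec R C M ` vecs C"

definition mat_kernel :: "'r set \<Rightarrow> 'c set \<Rightarrow> ('r \<Rightarrow> 'c \<Rightarrow> real) \<Rightarrow> ('c \<Rightarrow> real) set" where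
  "mat_kernel R C M = {x \<in> vecs C. mat_mult_vec R C M x = (\<lambda>_. 0)}"

definition mat_transpose :: "('r \<Rightarrow> 'c \<Rightarrow> real) \<Rightarrow> 'c \<Rightarrow> 'r \<Rightarrow> real" where
  "mat_transpose M = (\<lambda>j i. M i j)"

definition mat_rank :: "'r set \<Rightarrow> 'c set \<Rightarrow> ('r \<Rightarrow> 'c \<Rightarrow> real) \<Rightarrow> nat" where
  "mat_rank R C M = vector_space.dim (\<lambda>c x i. c * x i) (mat_image R C M)"

text \<open>A tuple of length \<open>q\<close> (an infinite sequence if \<open>q = \<infinity>\<close>) is a partial function
  whose domain is the set of positions \<open>1, \<dots>, q\<close>.\<close>

type_synonym 'l tuple = "nat \<rightharpoonup> 'l"

definition tuples :: "enat \<Rightarrow> 'l tuple set" where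
  "tuples q = {i. dom i = {n. 1 \<le> n \<and> enat n \<le> q}}"

definition trunc :: "nat \<Rightarrow> 'l tuple \<Rightarrow> 'l tuple" where
  "trunc k i = i |` {1..k}"

definition level :: "'l tuple set \<Rightarrow> nat \<Rightarrow> 'l tuple set" where
  "level I k = trunc k ` I"

text \<open>For finite \<open>q\<close> the finiteness condition is just finiteness of \<open>I = level I q\<close>.\<close>

definition index_tree :: "enat \<Rightarrow> 'l tuple set \<Rightarrow> bool" where
  "index_tree q I \<longleftrightarrow> I \<subseteq> tuples q \<and> (\<forall>k\<ge>1. enat k \<le> q \<longrightarrow> finite (level I k))"

definition wavelet_index_set :: "'l tuple set \<Rightarrow> nat \<Rightarrow> 'l tuple set \<Rightarrow> bool" where
  "wavelet_index_set I k J \<longleftrightarrow>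
     finite J \<and> J \<subseteq> tuples (enat k) \<and>
     trunc (k - 1) ` J = level I (k - 1) \<and>
     (\<forall>i\<in>level I (k - 1).
        int (card {j \<in> J. trunc (k - 1) j = i}) =
        int (card {t \<in> level I k. trunc (k - 1) t = i}) - 1)"

text \<open>Throughout, \<open>\<phi> k i\<close> is the measurement function at level \<open>k\<close> with label \<open>i \<in> level I k\<close>.\<close>

definition gamblet ::
    "'l tuple set \<Rightarrow> (nat \<Rightarrow> 'l tuple \<Rightarrow> ('b::banach \<Rightarrow>\<^sub>L real)) \<Rightarrow> nat \<Rightarrow> 'l tuple \<Rightarrow> 'b" where
  "gamblet I \<phi> k i =
     arg_min norm (\<lambda>\<psi>. \<forall>j\<in>level I k. blinfun_apply (\<phi> k j) \<psi> = (if i = j then 1 else 0))"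

definition V_space ::
    "'l tuple set \<Rightarrow> (nat \<Rightarrow> 'l tuple \<Rightarrow> ('b::banach \<Rightarrow>\<^sub>L real)) \<Rightarrow> enat \<Rightarrow> 'b set" where
  "V_space I \<phi> q =
     (case q of
        enat k \<Rightarrow> span (gamblet I \<phi> k ` level I k)
      | \<infinity> \<Rightarrow> closure (\<Union>k\<in>{1..}. span (gamblet I \<phi> k ` level I k)))"

definition u_level ::
    "'l tuple set \<Rightarrow> (nat \<Rightarrow> 'l tuple \<Rightarrow> ('b::banach \<Rightarrow>\<^sub>L real)) \<Rightarrow> nat \<Rightarrow> 'b \<Rightarrow> 'b" where
  "u_level I \<phi> k u = (\<Sum>i\<in>level I k. blinfun_apply (\<phi> k i) u *\<^sub>R gamblet I \<phi> k i)"

definition u_approx ::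
    "'l tuple set \<Rightarrow> (nat \<Rightarrow> 'l tuple \<Rightarrow> ('b::banach \<Rightarrow>\<^sub>L real)) \<Rightarrow> enat \<Rightarrow> 'b \<Rightarrow> 'b" where
  "u_approx I \<phi> q u =
     (case q of enat k \<Rightarrow> u_level I \<phi> k u | \<infinity> \<Rightarrow> lim (\<lambda>k. u_level I \<phi> k u))"

definition wavelet ::
    "'l tuple set \<Rightarrow> (nat \<Rightarrow> 'l tuple \<Rightarrow> ('b::banach \<Rightarrow>\<^sub>L real)) \<Rightarrow>
     (nat \<Rightarrow> 'l tuple \<Rightarrow> 'l tuple \<Rightarrow> real) \<Rightarrow> nat \<Rightarrow> 'l tuple \<Rightarrow> 'b" where
  "wavelet I \<phi> W k i = (\<Sum>j\<in>level I k. W k i j *\<^sub>R gamblet I \<phi> k j)"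

definition W_space ::
    "'l tuple set \<Rightarrow> (nat \<Rightarrow> 'l tuple \<Rightarrow> ('b::banach \<Rightarrow>\<^sub>L real)) \<Rightarrow>
     (nat \<Rightarrow> 'l tuple set) \<Rightarrow> (nat \<Rightarrow> 'l tuple \<Rightarrow> 'l tuple \<Rightarrow> real) \<Rightarrow> nat \<Rightarrow> 'b set" where
  "W_space I \<phi> J W k = span (wavelet I \<phi> W k ` J k)"

text \<open>The summands of the decomposition are indexed by \<open>{1..q + 1}\<close> in \<open>enat\<close>. Index \<open>q + 1\<close> is the
  orthogonal complement of \<open>V_space I \<phi> q\<close>; for \<open>q = \<infinity>\<close> this is the index \<open>\<infinity> + 1 = \<infinity>\<close>, which
  does not collide with a level, all levels being finite.\<close>

definition summand_space ::
    "(('b::banach \<Rightarrow>\<^sub>L real) \<Rightarrow> 'b) \<Rightarrow> enat \<Rightarrow> 'l tuple set \<Rightarrow>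
     (nat \<Rightarrow> 'l tuple \<Rightarrow> ('b \<Rightarrow>\<^sub>L real)) \<Rightarrow>
     (nat \<Rightarrow> 'l tuple set) \<Rightarrow> (nat \<Rightarrow> 'l tuple \<Rightarrow> 'l tuple \<Rightarrow> real) \<Rightarrow> enat \<Rightarrow> 'b set" where
  "summand_space Q q I \<phi> J W k =
     (if k = 1 then V_space I \<phi> 1
      else if k = q + 1 then orth_complement_in (scalar_prod Q) (V_space I \<phi> q) UNIV
      else W_space I \<phi> J W (the_enat k))"

definition u_component ::
    "enat \<Rightarrow> 'l tuple set \<Rightarrow> (nat \<Rightarrow> 'l tuple \<Rightarrow> ('b::banach \<Rightarrow>\<^sub>L real)) \<Rightarrow> 'b \<Rightarrow> enat \<Rightarrow> 'b" where
  "u_component q I \<phi> u k =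
     (if k = 1 then u_approx I \<phi> 1 u
      else if k = q + 1 then u - u_approx I \<phi> q u
      else u_approx I \<phi> k u - u_approx I \<phi> (k - 1) u)"

end

theory Submission
  imports Defs
begin

text \<open>
  The constraint \<open>[\<phi>, v] = 0\<close> says that \<open>v\<close> is orthogonal to \<open>Q \<phi>\<close>. Hence the minimal-norm dual
  vectors \<open>\<psi>\<^bsup>(k)\<^esup>\<close> are the basis of the span of the \<open>Q \<phi>\<^bsup>(k)\<^esup>\<close> dual to the \<open>\<phi>\<^bsup>(k)\<^esup>\<close>, and \<open>u\<^bsup>(k)\<^esup>\<close> is the
  orthogonal projection onto that span. Nesting of the measurements makes these spans
  increase with \<open>k\<close>. A vector \<open>\<Sum>\<^sub>j x\<^sub>j \<psi>\<^sub>j\<^bsup>(k)\<^esup>\<close> is orthogonal to the previous span iff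
  \<open>x \<in> Ker \<pi>\<^bsup>(k-1,k)\<^esup> = Im W\<^bsup>(k),T\<^esup>\<close>, that is, iff it is a combination of the \<open>\<chi>\<^bsup>(k)\<^esup>\<close>.
  The decomposition of \<open>u\<close> is then the telescoping sum of the projections. For \<open>q = \<infinity>\<close> the
  norms of the projections are monotone and bounded by \<open>\<parallel>u\<parallel>\<close>, so by Pythagoras the projections form a
  Cauchy sequence. The series converges unconditionally because an orthogonal partial sum only gets
  closer to \<open>u\<close> when terms are added.
\<close>

subsection \<open>Independent families and full-rank matrices\<close>

text \<open>Moves independence to coefficients indexed by labels, the form on which matrices
  act.\<close>

lemma lin_indep_family_iff:
  assumes "finite A"
  shows "lin_indep_family f A \<longleftrightarrow>
    (\<forall>c. (\<Sum>i\<in>A. c i *\<^sub>R f i) = 0 \<longrightarrow> (\<forall>i\<in>A. c i = 0))" (is "_ \<longleftrightarrow> ?R")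
proof
  assume l: "lin_indep_family f A"
  hence inj: "inj_on f A" and ind: "independent (f ` A)"
    by (auto simp: lin_indep_family_def)
  show ?R
  proof (intro allI impI ballI)
    fix c i assume s: "(\<Sum>i\<in>A. c i *\<^sub>R f i) = 0" and i: "i \<in> A"
    have "(\<Sum>v\<in>f ` A. c (inv_into A f v) *\<^sub>R v) = (\<Sum>i\<in>A. c i *\<^sub>R f i)"
      unfolding sum.reindex[OF inj] by (rule sum.cong) (simp_all add: inj)
    with s have "\<forall>v\<in>f ` A. c (inv_into A f v) = 0"
      using ind dependent_finite[OF finite_imageI[OF assms], of f] by auto
    then have "c (inv_into A f (f i)) = 0" using i by blast
    then show "c i = 0" using i inj by simp
  qed
next
  assume R: ?R
  have inj: "inj_on f A"
  proof (rule inj_onI, rule ccontr)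
    fix i j assume ij: "i \<in> A" "j \<in> A" "f i = f j" "i \<noteq> j"
    \<comment> \<open>If two labels share a vector, the difference of their indicators is a
      nontrivial vanishing combination.\<close>
    let ?c = "\<lambda>k. (if k = i then 1 else 0) - (if k = j then 1 else 0 :: real)"
    have "(\<Sum>k\<in>A. ?c k *\<^sub>R f k)
        = (\<Sum>k\<in>A. if k = i then f k else 0) - (\<Sum>k\<in>A. if k = j then f k else 0)"
      unfolding sum_subtractf[symmetric] by (rule sum.cong) (auto simp: algebra_simps)
    also have "\<dots> = 0" using ij assms by simp
    finally have "\<forall>k\<in>A. ?c k = 0" by (rule R[rule_format, THEN ballI])
    then have "?c i = 0" using ij(1) by (rule bspec)
    then show False using ij(4) by simp
  qed
  have "independent (f ` A)"
  proof
    assume "dependent (f ` A)"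
    then obtain u v where u: "v \<in> f ` A" "u v \<noteq> 0" "(\<Sum>v\<in>f ` A. u v *\<^sub>R v) = 0"
      using assms by (auto simp: dependent_finite)
    have "(\<Sum>i\<in>A. u (f i) *\<^sub>R f i) = 0"
      using u(3) inj by (simp add: sum.reindex)
    from R[rule_format, OF this] u show False by auto
  qed
  with inj show "lin_indep_family f A" by (simp add: lin_indep_family_def)
qed

text \<open>Coefficients are attached to labels, not to vectors, so the right-hand side matches
  \<open>mat_image\<close> even if \<open>f\<close> repeats values.\<close>

lemma span_image_eq_sums:
  fixes f :: "'i \<Rightarrow> 'v::real_vector"
  assumes "finite A"
  shows "span (f ` A) = (\<lambda>c. \<Sum>i\<in>A. c i *\<^sub>R f i) ` vecs A"
proof
  have "subspace ((\<lambda>c. \<Sum>i\<in>A. c i *\<^sub>R f i) ` vecs A)"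
  proof (rule subspaceI)
    show "0 \<in> (\<lambda>c. \<Sum>i\<in>A. c i *\<^sub>R f i) ` vecs A"
      by (rule image_eqI[of _ _ "\<lambda>_. 0"]) (auto simp: vecs_def)
  next
    fix x y assume "x \<in> (\<lambda>c. \<Sum>i\<in>A. c i *\<^sub>R f i) ` vecs A" "y \<in> (\<lambda>c. \<Sum>i\<in>A. c i *\<^sub>R f i) ` vecs A"
    then obtain c d where "c \<in> vecs A" "d \<in> vecs A"
      "x = (\<Sum>i\<in>A. c i *\<^sub>R f i)" "y = (\<Sum>i\<in>A. d i *\<^sub>R f i)" by auto
    then show "x + y \<in> (\<lambda>c. \<Sum>i\<in>A. c i *\<^sub>R f i) ` vecs A"
      by (intro image_eqI[of _ _ "\<lambda>i. c i + d i"])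
        (auto simp: vecs_def scaleR_add_left sum.distrib)
  next
    fix r x assume "x \<in> (\<lambda>c. \<Sum>i\<in>A. c i *\<^sub>R f i) ` vecs A"
    then obtain c where "c \<in> vecs A" "x = (\<Sum>i\<in>A. c i *\<^sub>R f i)" by auto
    then show "r *\<^sub>R x \<in> (\<lambda>c. \<Sum>i\<in>A. c i *\<^sub>R f i) ` vecs A"
      by (intro image_eqI[of _ _ "\<lambda>i. r * c i"]) (auto simp: vecs_def scaleR_sum_right)
  qed
  moreover have "f ` A \<subseteq> (\<lambda>c. \<Sum>i\<in>A. c i *\<^sub>R f i) ` vecs A"
  proof safe
    fix i assume "i \<in> A"
    then show "f i \<in> (\<lambda>c. \<Sum>i\<in>A. c i *\<^sub>R f i) ` vecs A"
      using assms
      by (intro image_eqI[of _ _ "\<lambda>j. if j = i then 1 else 0"])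
        (auto simp: vecs_def if_distrib[of "\<lambda>r. r *\<^sub>R _"] cong: if_cong)
  qed
  ultimately show "span (f ` A) \<subseteq> (\<lambda>c. \<Sum>i\<in>A. c i *\<^sub>R f i) ` vecs A"
    by (intro span_minimal)
  show "(\<lambda>c. \<Sum>i\<in>A. c i *\<^sub>R f i) ` vecs A \<subseteq> span (f ` A)"
    by (auto intro!: span_sum intro: span_scale span_base)
qed

lemma sum_fun_apply: "(\<Sum>i\<in>A. g i) n = (\<Sum>i\<in>A. g i n)"
  by (induction A rule: infinite_finite_induct) simp_all

text \<open>\<open>mat_rank\<close> measures dimension for an explicit scaling of functions; this
  gives access to span and dimension for that scaling.\<close>

lemma vector_space_fun: "vector_space (\<lambda>c (x :: 'i \<Rightarrow> real) i. c * x i)"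
  by unfold_locales (auto simp: fun_eq_iff algebra_simps)

text \<open>A nontrivial relation \<open>c\<close> between the rows puts the image into the hyperplane \<open>c\<^sup>\<bottom>\<close>, which
  is spanned by the \<open>card R - 1\<close> vectors \<open>e\<^sub>i - (c\<^sub>i / c\<^sub>m) e\<^sub>m\<close>, \<open>i \<noteq> m\<close>.\<close>

lemma full_rank_rows_independent:
  assumes R: "finite R" and C: "finite C"
    and rank: "mat_rank R C M = card R"
    and c: "\<And>j. j \<in> C \<Longrightarrow> (\<Sum>i\<in>R. c i * M i j) = 0"
    and m: "m \<in> R"
  shows "c m = 0"
proof (rule ccontr)
  assume nz: "c m \<noteq> 0"
  interpret F: vector_space "\<lambda>c (x :: 'a \<Rightarrow> real) i. c * x i" by (rule vector_space_fun)
  define b where "b i = (\<lambda>n. (if n = i then 1 else 0) - (if n = m then c i / c m else 0))" for i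
  have "mat_image R C M \<subseteq> F.span (b ` (R - {m}))"
  proof
    fix y assume "y \<in> mat_image R C M"
    then obtain x where y: "y = mat_mult_vec R C M x" by (auto simp: mat_image_def)
    have "(\<Sum>i\<in>R. c i * y i) = (\<Sum>i\<in>R. \<Sum>j\<in>C. c i * M i j * x j)"
      by (simp add: y mat_mult_vec_def sum_distrib_left mult.assoc)
    also have "\<dots> = (\<Sum>j\<in>C. (\<Sum>i\<in>R. c i * M i j) * x j)"
      by (subst sum.swap) (simp add: sum_distrib_right)
    also have "\<dots> = 0" using c by simp
    finally have "c m * y m + (\<Sum>i\<in>R - {m}. c i * y i) = 0"
      using R m by (simp add: sum.remove)
    hence ym: "y m = - (\<Sum>i\<in>R - {m}. c i * y i) / c m"
      using nz by (simp add: field_simps)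
    have "y = (\<Sum>i\<in>R - {m}. (\<lambda>n. y i * b i n))"
    proof
      fix n
      have "(\<Sum>i\<in>R - {m}. (\<lambda>n. y i * b i n)) n = (\<Sum>i\<in>R - {m}. y i * b i n)"
        by (rule sum_fun_apply)
      also have "\<dots> = (\<Sum>i\<in>R - {m}. if n = i then y i else 0)
          - (if n = m then (\<Sum>i\<in>R - {m}. c i * y i) / c m else 0)"
        by (auto simp: b_def algebra_simps sum_subtractf sum_divide_distrib
            if_distrib[of "\<lambda>r. _ * r"] cong: if_cong)
      also have "\<dots> = y n"
        using R ym by (auto simp: y mat_mult_vec_def)
      finally show "y n = (\<Sum>i\<in>R - {m}. (\<lambda>n. y i * b i n)) n" by simp
    qed
    moreover have "\<dots> \<in> F.span (b ` (R - {m}))"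
      by (intro F.span_sum F.span_scale F.span_base) auto
    ultimately show "y \<in> F.span (b ` (R - {m}))" by simp
  qed
  hence "F.dim (mat_image R C M) \<le> card (b ` (R - {m}))"
    using R by (intro F.dim_le_card) auto
  also have "\<dots> \<le> card (R - {m})" using R by (intro card_image_le) auto
  also have "\<dots> < card R" using R m by (intro psubset_card_mono) auto
  finally show False using rank by (simp add: mat_rank_def)
qed

text \<open>A relation \<open>c\<close> among the \<open>f i\<close> becomes, after swapping sums, a
  relation among the \<open>g j\<close> with coefficients \<open>c\<close> times \<open>M\<close>.
  Independence of \<open>g\<close> makes these vanish, and full row rank then forces
  \<open>c\<close> to be zero.\<close>

lemma lin_indep_family_full_rank:
  assumes R: "finite R" and C: "finite C"
    and rank: "mat_rank R C M = card R"
    and g: "lin_indep_family g C"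
    and f: "\<And>i. i \<in> R \<Longrightarrow> f i = (\<Sum>j\<in>C. M i j *\<^sub>R g j)"
  shows "lin_indep_family f R"
  unfolding lin_indep_family_iff[OF R]
proof (intro allI impI ballI)
  fix c i assume s: "(\<Sum>i\<in>R. c i *\<^sub>R f i) = 0" and i: "i \<in> R"
  have "0 = (\<Sum>i\<in>R. \<Sum>j\<in>C. (c i * M i j) *\<^sub>R g j)"
    unfolding s[symmetric] by (rule sum.cong) (simp_all add: f scaleR_sum_right)
  also have "\<dots> = (\<Sum>j\<in>C. (\<Sum>i\<in>R. c i * M i j) *\<^sub>R g j)"
    by (subst sum.swap) (simp add: scaleR_sum_left)
  finally have "\<forall>j\<in>C. (\<Sum>i\<in>R. c i * M i j) = 0"
    using g unfolding lin_indep_family_iff[OF C] by metis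
  thus "c i = 0" using full_rank_rows_independent[OF R C rank _ i] by blast
qed

subsection \<open>The quadratic norm and orthogonal projections\<close>

locale quadratic_banach =
  fixes Q :: "('b::banach \<Rightarrow>\<^sub>L real) \<Rightarrow> 'b"
  assumes sym_pos: "sym_pos_bijection Q"
    and quadratic: "quadratic_norm Q"
begin

abbreviation ip :: "'b \<Rightarrow> 'b \<Rightarrow> real" where
  "ip \<equiv> scalar_prod Q"

lemma linear_Q: "linear Q" and bij_Q: "bij Q"
  using sym_pos by (auto simp: sym_pos_bijection_def)

text \<open>The Riesz identity: \<open>Q f\<close> represents the functional \<open>f\<close>, which
  turns statements about measurements into statements about orthogonality.\<close>

lemma ip_Q: "ip (Q f) v = f v"
  using bij_Q by (simp add: scalar_prod_def bij_is_inj)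

lemma Q_cases: obtains f where "u = Q f"
  using bij_Q by (metis bij_pointE)

lemma ip_commute: "ip u v = ip v u"
proof -
  obtain f g where "u = Q f" "v = Q g" by (metis Q_cases)
  then show ?thesis using sym_pos by (simp add: ip_Q sym_pos_bijection_def)
qed

lemma bounded_linear_ip: "bounded_linear (ip u)"
  unfolding scalar_prod_def by (rule blinfun.bounded_linear_right)

lemma ip_right:
  "ip u 0 = 0" "ip u (v + w) = ip u v + ip u w" "ip u (v - w) = ip u v - ip u w"
  "ip u (r *\<^sub>R v) = r * ip u v" "ip u (sum h A) = (\<Sum>i\<in>A. ip u (h i))"
  by (simp_all add: scalar_prod_def blinfun.bilinear_simps blinfun.sum_right)

lemma ip_left:
  "ip 0 u = 0" "ip (v + w) u = ip v u + ip w u" "ip (v - w) u = ip v u - ip w u"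
  "ip (r *\<^sub>R v) u = r * ip v u" "ip (sum h A) u = (\<Sum>i\<in>A. ip (h i) u)"
  by (simp_all add: ip_commute[of _ u] ip_right)

lemma ip_self: "ip u u = (norm u)\<^sup>2"
  using quadratic by (simp add: quadratic_norm_def scalar_prod_def)

lemma ip_self_eq_0_iff: "ip u u = 0 \<longleftrightarrow> u = 0"
  by (simp add: ip_self)

lemma subspace_orth: "subspace {v. \<forall>s\<in>S. ip s v = 0}"
  by (auto intro!: subspaceI simp: ip_right)

lemma orth_span_iff: "(\<forall>s\<in>span S. ip s v = 0) \<longleftrightarrow> (\<forall>s\<in>S. ip s v = 0)"
proof
  assume "\<forall>s\<in>S. ip s v = 0"
  then have "span S \<subseteq> {s. \<forall>t\<in>{v}. ip t s = 0}"
    by (intro span_minimal subspace_orth) (auto simp: ip_commute)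
  then show "\<forall>s\<in>span S. ip s v = 0" by (auto simp: ip_commute)
qed (simp add: span_base)

lemma orth_closure:
  assumes "\<And>s. s \<in> S \<Longrightarrow> ip s v = 0" "t \<in> closure S"
  shows "ip t v = 0"
proof -
  have "closed {s. ip v s = 0}"
    by (intro closed_Collect_eq continuous_intros
        linear_continuous_on[OF bounded_linear_ip])
  then have "closure S \<subseteq> {s. ip v s = 0}"
    using assms(1) by (intro closure_minimal) (auto simp: ip_commute)
  then show ?thesis using assms(2) by (auto simp: ip_commute)
qed

text \<open>One Gram-Schmidt step per induction step: the hypothesis is used for \<open>v\<close>
  and also for the new vector \<open>b\<close>, whose residual \<open>e\<close> is orthogonal to the
  old span. Projecting \<open>v\<close> onto \<open>e\<close> supplies the missing term.\<close>

lemma projection_exists: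
  assumes "finite B"
  shows "\<exists>p\<in>span B. \<forall>s\<in>span B. ip s (v - p) = 0"
  using assms
proof (induction B arbitrary: v)
  case empty
  show ?case by (simp add: ip_left)
next
  case (insert b B)
  from insert.IH obtain p where p: "p \<in> span B" "\<forall>s\<in>span B. ip s (v - p) = 0" by blast
  from insert.IH obtain r where r: "r \<in> span B" "\<forall>s\<in>span B. ip s (b - r) = 0" by blast
  define e where "e = b - r"
  have sub: "span B \<subseteq> span (insert b B)" by (intro span_mono) auto
  have e: "e \<in> span (insert b B)"
    unfolding e_def using r(1) sub by (intro span_diff) (auto intro: span_base)
  \<comment> \<open>If \<open>e = 0\<close>, the coefficient is the junk value \<open>x / 0 = 0\<close>, which is the right one.\<close>
  let ?p = "p + (ip e v / ip e e) *\<^sub>R e"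
  have B: "ip s (v - ?p) = 0" if "s \<in> span B" for s
    using p(2) r(2) that by (simp add: ip_right e_def)
  have "ip e p = 0" using r(2) p(1) by (simp add: e_def ip_commute[of _ p])
  then have "ip e (v - ?p) = 0"
    by (cases "e = 0") (simp_all add: ip_left ip_right ip_self_eq_0_iff)
  moreover have "ip b (v - ?p) = ip e (v - ?p) + ip r (v - ?p)"
    by (simp add: e_def ip_left)
  ultimately have "ip b (v - ?p) = 0" using B[OF r(1)] by simp
  then have "\<forall>s\<in>span (insert b B). ip s (v - ?p) = 0"
    unfolding orth_span_iff using B by (auto intro: span_base)
  moreover have "?p \<in> span (insert b B)"
    using p(1) sub e by (intro span_add span_scale) auto
  ultimately show ?case by blast
qed

text \<open>Project \<open>Q (f i)\<close> onto the span of the other representatives. The residual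
  is annihilated by the other functionals, and independence keeps it nonzero, so it can be scaled to
  have value 1 under \<open>f i\<close>.\<close>

lemma dual_vector_exists:
  assumes A: "finite A" and f: "lin_indep_family f A" and i: "i \<in> A"
  shows "\<exists>w\<in>span (Q ` f ` A). \<forall>j\<in>A. f j w = (if i = j then 1 else 0)"
proof -
  let ?S = "span (Q ` f ` (A - {i}))"
  have inj: "inj_on f A" and ind: "independent (f ` A)"
    using f by (auto simp: lin_indep_family_def)
  have "f ` (A - {i}) = f ` A - {f i}" using inj i by (auto simp: inj_on_def)
  then have "f i \<notin> span (f ` (A - {i}))" using ind i by (auto simp: dependent_def)
  then have nS: "Q (f i) \<notin> ?S"
    using bij_is_inj[OF bij_Q] by (simp add: linear_span_image[OF linear_Q] inj_image_mem_iff)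
  obtain p where p: "p \<in> ?S" "\<forall>s\<in>?S. ip s (Q (f i) - p) = 0"
    using projection_exists[of "Q ` f ` (A - {i})"] A by auto
  define w where "w = Q (f i) - p"
  have "w \<noteq> 0" using nS p(1) by (auto simp: w_def)
  then have nz: "ip w w \<noteq> 0" by (simp add: ip_self_eq_0_iff)
  \<comment> \<open>\<open>Q (f i)\<close> equals \<open>w + p\<close>, and \<open>p\<close> is
    orthogonal to \<open>w\<close>.\<close>
  have "f i w = ip w w + ip p w" by (simp add: w_def ip_Q[symmetric] ip_left)
  then have fi: "f i w = ip w w" using p by (simp add: w_def)
  have fj: "f j w = 0" if "j \<in> A" "j \<noteq> i" for j
  proof -
    have "Q (f j) \<in> ?S" using that by (intro span_base) auto
    then show ?thesis using p(2) by (simp add: w_def ip_Q[symmetric])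
  qed
  have "?S \<subseteq> span (Q ` f ` A)" by (intro span_mono) auto
  then have "w \<in> span (Q ` f ` A)"
    unfolding w_def using p(1) i by (intro span_diff) (auto intro: span_base)
  then show ?thesis
    using nz fi fj by (intro bexI[of _ "(1 / ip w w) *\<^sub>R w"])
      (auto simp: blinfun.scaleR_right intro: span_scale)
qed

text \<open>Two feasible vectors differ by something annihilated by every \<open>f j\<close>, hence
  orthogonal to \<open>w\<close>. Pythagoras then gives minimality and also uniqueness, which is
  what pins down the choice made by \<open>arg_min\<close>.\<close>

lemma arg_min_norm_eq:
  assumes w: "w \<in> span (Q ` f ` A)" "\<forall>j\<in>A. blinfun_apply (f j) w = d j"
  shows "arg_min norm (\<lambda>v. \<forall>j\<in>A. blinfun_apply (f j) v = d j) = w"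
proof -
  have pyth: "(norm v)\<^sup>2 = (norm w)\<^sup>2 + (norm (v - w))\<^sup>2"
    if "\<forall>j\<in>A. f j v = d j" for v
  proof -
    have "\<forall>s\<in>Q ` f ` A. ip s (v - w) = 0"
      using that w(2) by (auto simp: ip_Q blinfun.diff_right)
    then have "ip w (v - w) = 0" using w(1) orth_span_iff by blast
    then show ?thesis
      by (simp add: ip_self[symmetric] ip_left ip_right ip_commute[of v w])
  qed
  have le: "norm w \<le> norm v" if "\<forall>j\<in>A. f j v = d j" for v
    using pyth[OF that] by (simp add: power2_le_imp_le)
  show ?thesis
    unfolding arg_min_def
  proof (rule some_equality)
    show "is_arg_min norm (\<lambda>v. \<forall>j\<in>A. blinfun_apply (f j) v = d j) w"
      using w(2) le by (auto simp: is_arg_min_linorder)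
  next
    fix v assume "is_arg_min norm (\<lambda>v. \<forall>j\<in>A. blinfun_apply (f j) v = d j) v"
    then have v: "\<forall>j\<in>A. f j v = d j" and "norm v \<le> norm w"
      using w(2) by (auto simp: is_arg_min_linorder)
    then have "(norm v)\<^sup>2 \<le> (norm w)\<^sup>2" by (intro power_mono) auto
    with pyth[OF v] show "v = w" by simp
  qed
qed

text \<open>Bessel's identity \<open>norm_eq\<close> shows that the residual can only shrink as
  \<open>F\<close> grows. One good finite set therefore controls all its finite supersets in
  \<open>K\<close>, as convergence along the finite subsets requires.\<close>

lemma orthogonal_has_sum:
  assumes orth: "\<And>k l. k \<in> K \<Longrightarrow> l \<in> K \<Longrightarrow> k \<noteq> l \<Longrightarrow> ip (v k) (v l) = 0"
    and coeff: "\<And>k. k \<in> K \<Longrightarrow> ip (v k) u = ip (v k) (v k)"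
    and approx: "\<And>e. e > 0 \<Longrightarrow> \<exists>F. finite F \<and> F \<subseteq> K \<and> norm (u - sum v F) < e"
  shows "(v has_sum u) K"
proof -
  have norm_eq: "(norm (u - sum v F))\<^sup>2 = (norm u)\<^sup>2 - (\<Sum>k\<in>F. (norm (v k))\<^sup>2)"
    if F: "finite F" "F \<subseteq> K" for F
  proof -
    have "ip (v k) (sum v F) = ip (v k) (v k)" if "k \<in> F" for k
    proof -
      have "ip (v k) (sum v F) = (\<Sum>l\<in>F. if l = k then ip (v k) (v k) else 0)"
        unfolding ip_right using F that orth[of k] by (intro sum.cong) auto
      then show ?thesis using F that by simp
    qed
    then have "ip (sum v F) (sum v F) = (\<Sum>k\<in>F. ip (v k) (v k))"
      by (simp add: ip_left)
    moreover have "ip (sum v F) u = (\<Sum>k\<in>F. ip (v k) (v k))"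
      using F coeff by (auto simp: ip_left intro!: sum.cong)
    ultimately show ?thesis
      by (simp add: ip_self[symmetric] ip_right(3) ip_left(3) ip_commute[of u "sum v F"])
  qed
  show ?thesis
    unfolding has_sum_def tendsto_iff eventually_finite_subsets_at_top
  proof (intro allI impI)
    fix e :: real assume "e > 0"
    then obtain F where F: "finite F" "F \<subseteq> K" "norm (u - sum v F) < e" using approx by blast
    have "dist (sum v G) u < e" if G: "finite G" "F \<subseteq> G" "G \<subseteq> K" for G
    proof -
      have "(\<Sum>k\<in>F. (norm (v k))\<^sup>2) \<le> (\<Sum>k\<in>G. (norm (v k))\<^sup>2)"
        using G by (intro sum_mono2) auto
      then have "(norm (u - sum v G))\<^sup>2 \<le> (norm (u - sum v F))\<^sup>2"
        using norm_eq[OF F(1,2)] norm_eq[OF G(1,3)] by simp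
      then have "norm (u - sum v G) \<le> norm (u - sum v F)" by (rule power2_le_imp_le) simp
      then show ?thesis using F(3) by (simp add: dist_norm norm_minus_commute)
    qed
    with F(1,2) show "\<exists>X. finite X \<and> X \<subseteq> K \<and>
        (\<forall>Y. finite Y \<and> X \<subseteq> Y \<and> Y \<subseteq> K \<longrightarrow> dist (sum v Y) u < e)"
      by blast
  qed
qed

text \<open>The difference \<open>h\<close> of two decompositions sums to zero. Applying the
  continuous functional \<open>ip (h k)\<close> termwise removes every term except the one at
  \<open>k\<close>, so \<open>h k\<close> has norm zero.\<close>

lemma orthogonal_decomposition_unique:
  assumes orth: "\<And>k l x y. k \<in> K \<Longrightarrow> l \<in> K \<Longrightarrow> k \<noteq> l \<Longrightarrow> x \<in> S k \<Longrightarrow> y \<in> S l \<Longrightarrow> ip x y = 0"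
    and sub: "\<And>k. k \<in> K \<Longrightarrow> subspace (S k)"
    and f: "decomposes_as K S u f" and g: "decomposes_as K S u g" and k: "k \<in> K"
  shows "f k = g k"
proof -
  define h where "h l = f l - g l" for l
  have hS: "h l \<in> S l" if "l \<in> K" for l
    using f g that by (auto simp: h_def decomposes_as_def intro: subspace_diff[OF sub])
  have "((\<lambda>l. f l + (-1) *\<^sub>R g l) has_sum u + (-1) *\<^sub>R u) K"
    using f g by (intro has_sum_add has_sum_scaleR) (auto simp: decomposes_as_def)
  then have "(h has_sum 0) K" by (simp add: h_def[abs_def])
  then have "((\<lambda>l. ip (h k) (h l)) has_sum ip (h k) 0) K"
    using has_sum_bounded_linear[OF bounded_linear_ip] by (auto simp: o_def)
  moreover have "((\<lambda>l. ip (h k) (h l)) has_sum ip (h k) (h k)) K"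
    using k orth hS by (intro has_sum_finite_neutralI[of "{k}"]) auto
  ultimately have "ip (h k) (h k) = ip (h k) 0" by (rule has_sum_unique[rotated])
  then have "h k = 0" by (simp add: ip_right(1) ip_self_eq_0_iff)
  then show ?thesis by (simp add: h_def)
qed

subsection \<open>Gamblets of one level\<close>

context
  fixes I :: "'l tuple set" and \<phi> :: "nat \<Rightarrow> 'l tuple \<Rightarrow> ('b \<Rightarrow>\<^sub>L real)" and k :: nat
  assumes fin: "finite (level I k)" and ind: "lin_indep_family (\<phi> k) (level I k)"
begin

text \<open>The dual vector inside the span is feasible, so it is the minimizer that defines the
  gamblet.\<close>

lemma
  assumes "i \<in> level I k"
  shows gamblet_in_span: "gamblet I \<phi> k i \<in> span (Q ` \<phi> k ` level I k)"
    and gamblet_dual: "j \<in> level I k \<Longrightarrow> \<phi> k j (gamblet I \<phi> k i) = (if i = j then 1 else 0)"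
proof -
  obtain w where w: "w \<in> span (Q ` \<phi> k ` level I k)"
    "\<forall>j\<in>level I k. \<phi> k j w = (if i = j then 1 else 0)"
    using dual_vector_exists[OF fin ind assms] by blast
  then have "gamblet I \<phi> k i = w" unfolding gamblet_def by (rule arg_min_norm_eq)
  with w show "gamblet I \<phi> k i \<in> span (Q ` \<phi> k ` level I k)"
    "j \<in> level I k \<Longrightarrow> \<phi> k j (gamblet I \<phi> k i) = (if i = j then 1 else 0)"
    by auto
qed

lemma measurement_sum_gamblets:
  assumes "j \<in> level I k"
  shows "\<phi> k j (\<Sum>i\<in>level I k. c i *\<^sub>R gamblet I \<phi> k i) = c j"
proof -
  have "\<phi> k j (\<Sum>i\<in>level I k. c i *\<^sub>R gamblet I \<phi> k i)
      = (\<Sum>i\<in>level I k. if i = j then c i else 0)"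
    unfolding blinfun.sum_right
    by (rule sum.cong) (use assms in \<open>auto simp: blinfun.scaleR_right gamblet_dual\<close>)
  then show ?thesis using assms fin by simp
qed

lemma orth_span_measurements_iff:
  "(\<forall>s\<in>span (Q ` \<phi> k ` level I k). ip s v = 0) \<longleftrightarrow> (\<forall>j\<in>level I k. \<phi> k j v = 0)"
  unfolding orth_span_iff by (auto simp: ip_Q)

lemma u_level_in_span: "u_level I \<phi> k u \<in> span (Q ` \<phi> k ` level I k)"
  unfolding u_level_def by (intro span_sum span_scale gamblet_in_span)

lemma measurement_u_level: "j \<in> level I k \<Longrightarrow> \<phi> k j (u_level I \<phi> k u) = \<phi> k j u"
  unfolding u_level_def by (rule measurement_sum_gamblets)

text \<open>The residual lies in the span and, being annihilated by all measurements, is orthogonal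
  to the span; hence it is zero.\<close>

lemma u_level_fixes:
  assumes "v \<in> span (Q ` \<phi> k ` level I k)"
  shows "u_level I \<phi> k v = v"
proof -
  have "v - u_level I \<phi> k v \<in> span (Q ` \<phi> k ` level I k)"
    using assms u_level_in_span by (rule span_diff)
  moreover have "\<forall>j\<in>level I k. \<phi> k j (v - u_level I \<phi> k v) = 0"
    by (simp add: blinfun.diff_right measurement_u_level)
  ultimately have "ip (v - u_level I \<phi> k v) (v - u_level I \<phi> k v) = 0"
    using orth_span_measurements_iff by blast
  then show ?thesis by (simp add: ip_self_eq_0_iff)
qed

text \<open>Replaces gamblets by Riesz representatives of the measurements, to which the nesting
  relation applies directly.\<close>

lemma V_space_eq: "V_space I \<phi> (enat k) = span (Q ` \<phi> k ` level I k)"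
proof
  show "V_space I \<phi> (enat k) \<subseteq> span (Q ` \<phi> k ` level I k)"
    unfolding V_space_def enat.case
    by (intro span_minimal subspace_span) (auto intro: gamblet_in_span)
  show "span (Q ` \<phi> k ` level I k) \<subseteq> V_space I \<phi> (enat k)"
  proof
    fix v assume "v \<in> span (Q ` \<phi> k ` level I k)"
    then have "v = (\<Sum>i\<in>level I k. \<phi> k i v *\<^sub>R gamblet I \<phi> k i)"
      using u_level_fixes by (simp add: u_level_def)
    also have "\<dots> \<in> V_space I \<phi> (enat k)"
      unfolding V_space_def enat.case by (intro span_sum span_scale span_base imageI)
    finally show "v \<in> V_space I \<phi> (enat k)" .
  qed
qed

lemma orth_V_space_iff:
  "(\<forall>s\<in>V_space I \<phi> (enat k). ip s v = 0) \<longleftrightarrow> (\<forall>j\<in>level I k. \<phi> k j v = 0)"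
  unfolding V_space_eq by (rule orth_span_measurements_iff)

end

text \<open>Swapping sums, a combination of wavelets with coefficients \<open>c\<close> has gamblet
  coefficients given by the transpose of \<open>W k\<close> applied to \<open>c\<close>.\<close>

lemma W_space_eq:
  assumes "finite (J k)"
  shows "W_space I \<phi> J W k =
    (\<lambda>x. \<Sum>j\<in>level I k. x j *\<^sub>R gamblet I \<phi> k j) `
      mat_image (level I k) (J k) (mat_transpose (W k))"
proof -
  have "(\<Sum>i\<in>J k. c i *\<^sub>R wavelet I \<phi> W k i) =
      (\<Sum>j\<in>level I k. mat_mult_vec (level I k) (J k) (mat_transpose (W k)) c j *\<^sub>R
        gamblet I \<phi> k j)" for c
  proof -
    have "(\<Sum>i\<in>J k. c i *\<^sub>R wavelet I \<phi> W k i)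
        = (\<Sum>j\<in>level I k. \<Sum>i\<in>J k. (W k i j * c i) *\<^sub>R gamblet I \<phi> k j)"
      unfolding wavelet_def scaleR_sum_right by (subst sum.swap) (simp add: mult.commute)
    then show ?thesis
      by (simp add: mat_mult_vec_def mat_transpose_def scaleR_sum_left cong: sum.cong)
  qed
  then show ?thesis
    unfolding W_space_def span_image_eq_sums[OF assms] mat_image_def image_image by simp
qed

end

subsection \<open>The hierarchy of levels\<close>

text \<open>Independence is required here at every level; \<open>lin_indep_levels\<close> derives it
  from the hypotheses of the theorem.\<close>

locale gamblet_tree = quadratic_banach Q
  for Q :: "('b::banach \<Rightarrow>\<^sub>L real) \<Rightarrow> 'b" +
  fixes q :: enat
    and I :: "'l tuple set"
    and \<pi> :: "nat \<Rightarrow> 'l tuple \<Rightarrow> 'l tuple \<Rightarrow> real"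
    and \<phi> :: "nat \<Rightarrow> 'l tuple \<Rightarrow> ('b \<Rightarrow>\<^sub>L real)"
    and J :: "nat \<Rightarrow> 'l tuple set"
    and W :: "nat \<Rightarrow> 'l tuple \<Rightarrow> 'l tuple \<Rightarrow> real"
  assumes depth: "1 \<le> q"
    and fin: "\<And>k. 1 \<le> k \<Longrightarrow> enat k \<le> q \<Longrightarrow> finite (level I k)"
    and ind: "\<And>k. 1 \<le> k \<Longrightarrow> enat k \<le> q \<Longrightarrow> lin_indep_family (\<phi> k) (level I k)"
    and nesting: "\<And>k i. 1 \<le> k \<Longrightarrow> enat k < q \<Longrightarrow> i \<in> level I k \<Longrightarrow>
      \<phi> k i = (\<Sum>j\<in>level I (k + 1). \<pi> k i j *\<^sub>R \<phi> (k + 1) j)"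
    and fin_J: "\<And>k. 2 \<le> k \<Longrightarrow> enat k \<le> q \<Longrightarrow> finite (J k)"
    and W: "\<And>k. 2 \<le> k \<Longrightarrow> enat k \<le> q \<Longrightarrow>
      mat_image (level I k) (J k) (mat_transpose (W k)) =
      mat_kernel (level I (k - 1)) (level I k) (\<pi> (k - 1))"
begin

abbreviation V :: "nat \<Rightarrow> 'b set" where
  "V k \<equiv> V_space I \<phi> (enat k)"

abbreviation P :: "nat \<Rightarrow> 'b \<Rightarrow> 'b" where
  "P \<equiv> u_level I \<phi>"

lemma V_eq:
  assumes "1 \<le> k" "enat k \<le> q"
  shows "V k = span (Q ` \<phi> k ` level I k)"
  using fin[OF assms] ind[OF assms] by (rule V_space_eq)

lemma P_in_V: "1 \<le> k \<Longrightarrow> enat k \<le> q \<Longrightarrow> P k u \<in> V k"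
  by (simp add: V_eq u_level_in_span fin ind)

lemma orth_V_iff:
  assumes "1 \<le> k" "enat k \<le> q"
  shows "(\<forall>s\<in>V k. ip s v = 0) \<longleftrightarrow> (\<forall>j\<in>level I k. \<phi> k j v = 0)"
  using fin[OF assms] ind[OF assms] by (rule orth_V_space_iff)

text \<open>\<open>P k u\<close> reproduces the measurements of \<open>u\<close>, so the residual is
  annihilated by them. Together with \<open>P_in_V\<close> this makes \<open>P k\<close> the
  orthogonal projection onto \<open>V k\<close>.\<close>

lemma orth_residual:
  assumes "1 \<le> k" "enat k \<le> q" "s \<in> V k"
  shows "ip s (u - P k u) = 0"
proof -
  have "\<forall>j\<in>level I k. \<phi> k j (u - P k u) = 0"
    using measurement_u_level[of I k \<phi>] fin[OF assms(1,2)] ind[OF assms(1,2)]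
    by (simp add: blinfun.diff_right)
  then show ?thesis using orth_V_iff[OF assms(1,2)] assms(3) by blast
qed

lemma V_mono_Suc:
  assumes "1 \<le> k" "enat (Suc k) \<le> q"
  shows "V k \<subseteq> V (Suc k)"
proof -
  have lt: "enat k < q" using assms(2) by (metis enat_ord_simps(2) lessI less_le_trans)
  \<comment> \<open>Linearity of \<open>Q\<close> carries the nesting relation over to the
    representatives.\<close>
  have "Q (\<phi> k i) \<in> span (Q ` \<phi> (Suc k) ` level I (Suc k))" if "i \<in> level I k" for i
    unfolding nesting[OF assms(1) lt that] linear_sum[OF linear_Q] linear_scale[OF linear_Q]
    by (auto intro!: span_sum intro: span_scale span_base)
  then have "span (Q ` \<phi> k ` level I k) \<subseteq> span (Q ` \<phi> (Suc k) ` level I (Suc k))"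
    by (intro span_minimal) auto
  then show ?thesis using assms lt by (simp add: V_eq)
qed

lemma V_mono:
  assumes "1 \<le> k" and "k \<le> l" and "enat l \<le> q"
  shows "V k \<subseteq> V l"
  using assms(2,3)
proof (induction l rule: dec_induct)
  case (step n)
  have "enat n \<le> q"
    using step.prems by (metis enat_ord_simps(1) le_SucI order_refl order_trans)
  then have "V k \<subseteq> V n" by (rule step.IH)
  also have "V n \<subseteq> V (Suc n)" using step assms(1) by (intro V_mono_Suc) auto
  finally show ?case .
qed auto

lemma V_subset_V_top:
  assumes "1 \<le> k" "enat k \<le> q"
  shows "V k \<subseteq> V_space I \<phi> q"
proof (cases q)
  case (enat n)
  with assms show ?thesis using V_mono[of k n] by simp
next
  case infinity
  have "V k \<subseteq> (\<Union>k\<in>{1..}. V k)" using assms(1) by auto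
  also have "\<dots> \<subseteq> V_space I \<phi> q"
    unfolding infinity by (simp add: V_space_def closure_subset)
  finally show ?thesis .
qed

lemma W_space_orth_complement:
  assumes "2 \<le> k" "enat k \<le> q"
  shows "W_space I \<phi> J W k = orth_complement_in ip (V (k - 1)) (V k)"
proof -
  let ?A = "level I k" and ?s = "\<lambda>x. \<Sum>j\<in>level I k. x j *\<^sub>R gamblet I \<phi> k j"
  define m where "m = k - 1"
  have k: "k = m + 1" "1 \<le> m" "1 \<le> k" using assms(1) by (auto simp: m_def)
  have lt: "enat m < q" using assms(2) k(1) by (metis enat_ord_simps(2) less_add_one less_le_trans)
  note A = fin[OF k(3) assms(2)] ind[OF k(3) assms(2)]
  \<comment> \<open>By nesting, the coarse measurement of \<open>v\<close> with label
    \<open>i\<close> is row \<open>i\<close> of \<open>\<pi> m\<close> applied to the fine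
    measurements of \<open>v\<close>.\<close>
  have orth: "(\<forall>s\<in>V m. ip s v = 0) \<longleftrightarrow> (\<forall>i\<in>level I m. (\<Sum>j\<in>?A. \<pi> m i j * \<phi> k j v) = 0)" for v
    using orth_V_iff[OF k(2), of v] lt nesting[OF k(2) lt]
    by (simp add: k(1) blinfun.sum_left blinfun.scaleR_left cong: ball_cong)
  have "?s ` mat_kernel (level I m) ?A (\<pi> m) = orth_complement_in ip (V m) (V k)"
  proof (intro subset_antisym subsetI)
    fix v assume "v \<in> ?s ` mat_kernel (level I m) ?A (\<pi> m)"
    then obtain x where x: "mat_mult_vec (level I m) ?A (\<pi> m) x = (\<lambda>_. 0)" and v: "v = ?s x"
      by (auto simp: mat_kernel_def)
    have "\<phi> k j v = x j" if "j \<in> ?A" for j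
      unfolding v by (rule measurement_sum_gamblets) (rule A that)+
    moreover have "(\<Sum>j\<in>?A. \<pi> m i j * x j) = 0" if "i \<in> level I m" for i
      using fun_cong[OF x, of i] that by (simp add: mat_mult_vec_def)
    ultimately have "\<forall>s\<in>V m. ip s v = 0" unfolding orth by simp
    moreover have "v \<in> V k"
      unfolding v V_eq[OF k(3) assms(2)] by (intro span_sum span_scale gamblet_in_span A)
    ultimately show "v \<in> orth_complement_in ip (V m) (V k)"
      by (simp add: orth_complement_in_def)
  next
    fix v assume "v \<in> orth_complement_in ip (V m) (V k)"
    then have v: "v \<in> V k" and o: "\<forall>s\<in>V m. ip s v = 0" by (auto simp: orth_complement_in_def)
    \<comment> \<open>The gamblet coefficients of \<open>v\<close> are its measurements; they are
      extended by zero to become a vector in the sense of \<open>vecs\<close>.\<close>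
    let ?x = "\<lambda>j. if j \<in> ?A then \<phi> k j v else 0"
    have "v = P k v"
      using v u_level_fixes[where k = k and \<phi> = \<phi> and I = I, OF A] by (simp add: V_eq[OF k(3) assms(2)])
    then have "v = ?s ?x" by (simp add: u_level_def cong: sum.cong)
    moreover have "?x \<in> mat_kernel (level I m) ?A (\<pi> m)"
      using o unfolding orth by (simp add: mat_kernel_def vecs_def mat_mult_vec_def fun_eq_iff)
    ultimately show "v \<in> ?s ` mat_kernel (level I m) ?A (\<pi> m)" by (rule image_eqI)
  qed
  then show ?thesis
    using W_space_eq[where I = I and \<phi> = \<phi> and J = J and W = W, OF fin_J[OF assms]]
    unfolding W[OF assms] m_def by simp
qed

lemma W_space_subset_V: "2 \<le> k \<Longrightarrow> enat k \<le> q \<Longrightarrow> W_space I \<phi> J W k \<subseteq> V k"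
  by (auto simp: W_space_orth_complement orth_complement_in_def)

text \<open>Against a vector of \<open>V (k - 1)\<close>, both projections have the same scalar
  product as \<open>u\<close>, so their difference is orthogonal to it.\<close>

lemma increment_in_W_space:
  assumes "2 \<le> k" "enat k \<le> q"
  shows "P k u - P (k - 1) u \<in> W_space I \<phi> J W k"
proof -
  have k: "1 \<le> k - 1" "1 \<le> k" "k - 1 \<le> k" using assms(1) by auto
  have le: "enat (k - 1) \<le> q"
    using assms(2) k(3) by (metis enat_ord_simps(1) order_trans)
  note mono = V_mono[OF k(1,3) assms(2)]
  have "P k u - P (k - 1) u \<in> V k"
    using P_in_V[OF k(2) assms(2)] P_in_V[OF k(1) le] mono
    unfolding V_eq[OF k(2) assms(2)] by (blast intro: span_diff)
  moreover have "ip s (P k u - P (k - 1) u) = 0" if "s \<in> V (k - 1)" for s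
    using orth_residual[OF k(1) le that, of u]
      orth_residual[OF k(2) assms(2) subsetD[OF mono that], of u]
    by (simp add: ip_right)
  ultimately show ?thesis
    by (simp add: W_space_orth_complement[OF assms] orth_complement_in_def)
qed

section \<open>Convergence of the projections\<close>

lemma norm_increment:
  assumes "1 \<le> k" "k \<le> l" "enat l \<le> q"
  shows "(norm (P l u - P k u))\<^sup>2 = (norm (P l u))\<^sup>2 - (norm (P k u))\<^sup>2"
proof -
  have k: "enat k \<le> q" using assms(2,3) by (metis enat_ord_simps(1) order_trans)
  have l: "1 \<le> l" using assms(1,2) by simp
  \<comment> \<open>\<open>P k u\<close> lies in \<open>V k\<close> and in the larger
    \<open>V l\<close>, so it is orthogonal to both residuals.\<close>
  have "ip (P k u) (u - P k u) = 0" "ip (P k u) (u - P l u) = 0"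
    using orth_residual[OF assms(1) k P_in_V[OF assms(1) k]]
      orth_residual[OF l assms(3) subsetD[OF V_mono[OF assms] P_in_V[OF assms(1) k]]]
    by blast+
  then have "ip (P k u) (P l u) = ip (P k u) (P k u)" by (simp add: ip_right)
  then show ?thesis
    by (simp add: ip_self[symmetric] ip_right ip_left ip_commute[of "P l u" "P k u"])
qed

lemma norm_P_le:
  assumes "1 \<le> k" "enat k \<le> q"
  shows "norm (P k u) \<le> norm u"
proof -
  have "ip (P k u) (u - P k u) = 0"
    by (rule orth_residual[OF assms P_in_V[OF assms]])
  then have "(norm u)\<^sup>2 = (norm (P k u))\<^sup>2 + (norm (u - P k u))\<^sup>2"
    by (simp add: ip_self[symmetric] ip_right ip_left ip_commute[of u "P k u"])
  then show ?thesis by (simp add: power2_le_imp_le)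
qed

lemma convergent_P:
  assumes q: "q = \<infinity>"
  shows "convergent (\<lambda>k. P k u)"
proof -
  \<comment> \<open>The shift by \<open>Suc\<close> starts the sequence at level 1, since the
    assumptions concern levels from 1 on.\<close>
  let ?n = "\<lambda>k. (norm (P (Suc k) u))\<^sup>2"
  have n_diff: "(norm (P (Suc l) u - P (Suc k) u))\<^sup>2 = ?n l - ?n k" if "k \<le> l" for k l
    using that by (intro norm_increment) (auto simp: q)
  have "?n k \<le> ?n l" if "k \<le> l" for k l
    using n_diff[OF that] zero_le_power2[of "norm (P (Suc l) u - P (Suc k) u)"] by linarith
  then have "incseq ?n" by (simp add: incseq_def)
  moreover have "?n k \<le> (norm u)\<^sup>2" for k
    by (intro power_mono norm_P_le) (auto simp: q)
  ultimately obtain L where "?n \<longlonglongrightarrow> L" using incseq_convergent[of ?n "(norm u)\<^sup>2"] by blast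
  then have "convergent ?n" by (rule convergentI)
  then have "Cauchy ?n" by (rule convergent_Cauchy)
  have "Cauchy (\<lambda>k. P (Suc k) u)"
  proof (rule metric_CauchyI)
    fix e :: real assume "e > 0"
    then obtain M where M: "\<And>k l. k \<ge> M \<Longrightarrow> l \<ge> M \<Longrightarrow> dist (?n l) (?n k) < e\<^sup>2"
      using metric_CauchyD[OF \<open>Cauchy ?n\<close>, of "e\<^sup>2"] by fastforce
    have *: "dist (P (Suc l) u) (P (Suc k) u) < e" if "M \<le> k" "k \<le> l" for k l
    proof -
      have "(norm (P (Suc l) u - P (Suc k) u))\<^sup>2 < e\<^sup>2"
        using M[of k l] that n_diff[of k l] by (auto simp: dist_real_def)
      then show ?thesis using \<open>e > 0\<close> by (simp add: dist_norm power2_less_imp_less)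
    qed
    have "dist (P (Suc k) u) (P (Suc l) u) < e" if "M \<le> k" "M \<le> l" for k l
      using *[of k l] *[of l k] that by (cases k l rule: le_cases) (auto simp: dist_commute)
    then show "\<exists>M. \<forall>m\<ge>M. \<forall>n\<ge>M. dist (P (Suc m) u) (P (Suc n) u) < e" by blast
  qed
  then have "convergent (\<lambda>k. P (Suc k) u)" by (rule Cauchy_convergent)
  then show ?thesis by (subst (asm) convergent_Suc_iff)
qed

text \<open>The later proofs use the top projection only through these three facts, which hold for
  finite and infinite depth alike. For finite \<open>q\<close> the approximating level is
  \<open>q\<close> itself.\<close>

lemma u_approx_projection:
  shows u_approx_in_V_top: "u_approx I \<phi> q u \<in> V_space I \<phi> q"
    and orth_residual_top: "s \<in> V_space I \<phi> q \<Longrightarrow> ip s (u - u_approx I \<phi> q u) = 0"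
    and u_approx_approximable:
      "e > 0 \<Longrightarrow> \<exists>N\<ge>1. enat N \<le> q \<and> norm (u_approx I \<phi> q u - P N u) < e"
proof -
  let ?p = "u_approx I \<phi> q u"
  have "?p \<in> V_space I \<phi> q \<and> (\<forall>s\<in>V_space I \<phi> q. ip s (u - ?p) = 0) \<and>
    (\<forall>e>0. \<exists>N\<ge>1. enat N \<le> q \<and> norm (?p - P N u) < e)"
  proof (cases q)
    case (enat n)
    then have "1 \<le> n" using depth by (simp add: one_enat_def)
    then show ?thesis
      using P_in_V[of n u] orth_residual[of n _ u] enat
      by (auto simp: u_approx_def intro!: exI[of _ n])
  next
    case infinity
    then have "?p = lim (\<lambda>k. P k u)" by (simp add: u_approx_def)
    then have lim: "(\<lambda>k. P k u) \<longlonglongrightarrow> ?p"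
      using convergent_P[OF infinity, of u] by (simp add: convergent_LIMSEQ_iff)
    have Vq: "V_space I \<phi> q = closure (\<Union>k\<in>{1..}. V k)"
      unfolding infinity by (simp add: V_space_def)
    have "?p \<in> closure (\<Union>k\<in>{1..}. V k)"
      unfolding closure_sequential
    proof (intro exI conjI allI)
      show "(\<lambda>k. P (Suc k) u) \<longlonglongrightarrow> ?p" using lim by (rule LIMSEQ_Suc)
      show "P (Suc k) u \<in> (\<Union>k\<in>{1..}. V k)" for k
        using P_in_V[of "Suc k" u] by (auto simp: infinity)
    qed
    moreover have "ip s (u - ?p) = 0" if "s \<in> closure (\<Union>k\<in>{1..}. V k)" for s
    proof (rule orth_closure[OF _ that])
      fix s assume "s \<in> (\<Union>k\<in>{1..}. V k)"
      then obtain k where k: "1 \<le> k" "s \<in> V k" by auto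
      \<comment> \<open>Orthogonality to \<open>s\<close> is available from the level
        \<open>k\<close> of \<open>s\<close> onwards, which suffices for the limit.\<close>
      have "eventually (\<lambda>l. ip s (u - P l u) = 0) sequentially"
        using eventually_ge_at_top[of k]
      proof eventually_elim
        case (elim l)
        then show ?case
          using k V_mono[OF k(1) elim] by (intro orth_residual) (auto simp: infinity)
      qed
      then have "(\<lambda>l. ip s (u - P l u)) \<longlonglongrightarrow> 0" by (rule tendsto_eventually)
      moreover have "(\<lambda>l. ip s (u - P l u)) \<longlonglongrightarrow> ip s (u - ?p)"
        using lim by (intro bounded_linear.tendsto[OF bounded_linear_ip] tendsto_diff tendsto_const)
      ultimately show "ip s (u - ?p) = 0" by (rule LIMSEQ_unique[rotated])
    qed
    moreover have "\<exists>N\<ge>1. enat N \<le> q \<and> norm (?p - P N u) < e" if e: "e > 0" for e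
    proof -
      have "eventually (\<lambda>k. dist (P k u) ?p < e) sequentially"
        using lim e by (rule tendstoD)
      then have "eventually (\<lambda>k. 1 \<le> k \<and> dist (P k u) ?p < e) sequentially"
        using eventually_ge_at_top[of 1] by eventually_elim simp
      then obtain N where "1 \<le> N" "dist (P N u) ?p < e"
        by (auto simp: eventually_sequentially)
      then show ?thesis
        by (auto simp: infinity dist_norm norm_minus_commute)
    qed
    ultimately show ?thesis unfolding Vq by blast
  qed
  then show "?p \<in> V_space I \<phi> q" "s \<in> V_space I \<phi> q \<Longrightarrow> ip s (u - ?p) = 0"
    "e > 0 \<Longrightarrow> \<exists>N\<ge>1. enat N \<le> q \<and> norm (?p - P N u) < e"
    by blast+
qed

section \<open>Orthogonality of the summands and the telescoping series\<close>

abbreviation S :: "enat \<Rightarrow> 'b set" where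
  "S \<equiv> summand_space Q q I \<phi> J W"

abbreviation component :: "'b \<Rightarrow> enat \<Rightarrow> 'b" where
  "component \<equiv> u_component q I \<phi>"

text \<open>For infinite \<open>q\<close> the index range contains every finite level from 1 on, and
  its only other element is \<infinity>, which equals \<open>q + 1\<close>.\<close>

lemma index_cases:
  assumes "k \<in> {1..q + 1}"
  obtains (level) n where "k = enat n" "1 \<le> n" "enat n \<le> q" | (top) "k = q + 1"
proof (cases "k = q + 1")
  case False
  with assms have "k < q + 1" by (simp add: order_less_le)
  then obtain n where n: "k = enat n" by (metis enat_ord_simps(4) less_infinityE order_less_imp_not_less)
  then have "1 \<le> n" using assms by (simp add: one_enat_def)
  moreover have "enat n \<le> q"
    using \<open>k < q + 1\<close> n by (cases q) (auto simp: one_enat_def)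
  ultimately show ?thesis using n level by blast
qed (rule top)

lemma level_neq_top: "enat n \<le> q \<Longrightarrow> enat n \<noteq> q + 1"
  by (cases q) (auto simp: one_enat_def)

lemma level_in_index: "1 \<le> n \<Longrightarrow> enat n \<le> q \<Longrightarrow> enat n \<in> {1..q + 1}"
  by (cases q) (auto simp: one_enat_def)

lemma one_neq_top: "q + 1 \<noteq> 1"
  using depth by (cases q) (auto simp: one_enat_def)

lemma S_1: "S (enat (Suc 0)) = V (Suc 0)"
  by (simp add: summand_space_def one_enat_def)

lemma S_level: "2 \<le> n \<Longrightarrow> enat n \<le> q \<Longrightarrow> S (enat n) = W_space I \<phi> J W n"
  using level_neq_top[of n] by (auto simp: summand_space_def one_enat_def)

lemma S_top: "S (q + 1) = orth_complement_in ip (V_space I \<phi> q) UNIV"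
  by (simp add: summand_space_def one_neq_top)

lemma component_1: "component u (enat (Suc 0)) = P (Suc 0) u"
  by (simp add: u_component_def u_approx_def one_enat_def)

lemma component_level: "2 \<le> n \<Longrightarrow> enat n \<le> q \<Longrightarrow> component u (enat n) = P n u - P (n - 1) u"
  using level_neq_top[of n] by (auto simp: u_component_def u_approx_def one_enat_def)

lemma component_top: "component u (q + 1) = u - u_approx I \<phi> q u"
  by (simp add: u_component_def one_neq_top)

lemma S_subset_V:
  assumes "1 \<le> n" "enat n \<le> q"
  shows "S (enat n) \<subseteq> V n"
proof (cases "n = 1")
  case False
  with assms(1) have "2 \<le> n" by simp
  then show ?thesis using assms(2) W_space_subset_V by (simp add: S_level)
qed (simp add: S_1)

text \<open>The lower summand lies in some \<open>V n\<close>, and the higher one is orthogonal to a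
  space containing \<open>V n\<close>: the predecessor \<open>V (m - 1)\<close> at a wavelet level,
  the whole approximation space at the top.\<close>

lemma S_orth_less:
  assumes "k \<in> {1..q + 1}" "l \<in> {1..q + 1}" "k < l" "x \<in> S k" "y \<in> S l"
  shows "ip x y = 0"
proof -
  \<comment> \<open>The smaller of two indices cannot be \<open>q + 1\<close>.\<close>
  obtain n where n: "k = enat n" "1 \<le> n" "enat n \<le> q"
    using index_cases[OF assms(1)] assms(2,3) by (metis atLeastAtMost_iff leD)
  have x: "x \<in> V n" using S_subset_V n assms(4) by blast
  show ?thesis
    using assms(2)
  proof (cases rule: index_cases)
    case (level m)
    then have "n < m" using assms(3) n by simp
    then have m: "2 \<le> m" "n \<le> m - 1" using n(2) by auto
    have "enat (m - 1) \<le> q"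
      using level(3) by (metis diff_le_self enat_ord_simps(1) order_trans)
    then have "x \<in> V (m - 1)" using x V_mono[OF n(2) m(2)] by blast
    then show ?thesis
      using assms(5) level m
      by (auto simp: S_level W_space_orth_complement orth_complement_in_def)
  next
    case top
    then show ?thesis
      using assms(5) x V_subset_V_top[OF n(2,3)]
      by (auto simp: S_top orth_complement_in_def)
  qed
qed

lemma S_orth:
  assumes "k \<in> {1..q + 1}" "l \<in> {1..q + 1}" "k \<noteq> l" "x \<in> S k" "y \<in> S l"
  shows "ip x y = 0"
proof (cases "k < l")
  case True
  then show ?thesis using S_orth_less assms by blast
next
  case False
  with assms(3) have "l < k" by simp
  then have "ip y x = 0" using S_orth_less assms by blast
  then show ?thesis by (simp add: ip_commute)
qed

lemma subspace_S:
  assumes "k \<in> {1..q + 1}"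
  shows "subspace (S k)"
  using assms
proof (cases rule: index_cases)
  case (level n)
  show ?thesis
  proof (cases "n = 1")
    case True
    then show ?thesis by (simp add: level S_1 V_space_def)
  next
    case False
    then show ?thesis using level by (simp add: S_level W_space_def)
  qed
next
  case top
  then show ?thesis using subspace_orth by (simp add: S_top orth_complement_in_def)
qed

lemma component_in_S:
  assumes "k \<in> {1..q + 1}"
  shows "component u k \<in> S k"
  using assms
proof (cases rule: index_cases)
  case (level n)
  show ?thesis
  proof (cases "n = 1")
    case True
    then show ?thesis using level P_in_V by (simp add: S_1 component_1)
  next
    case False
    then have "2 \<le> n" using level(2) by simp
    then show ?thesis using level increment_in_W_space by (simp add: S_level component_level)
  qed
next
  case top
  then show ?thesis using orth_residual_top by (simp add: S_top component_top orth_complement_in_def)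
qed

lemma sum_component: "1 \<le> n \<Longrightarrow> enat n \<le> q \<Longrightarrow> (\<Sum>k=1..n. component u (enat k)) = P n u"
proof (induction n rule: nat_induct_at_least)
  case base
  then show ?case by (simp add: component_1)
next
  case (Suc n)
  have "enat n \<le> q" using Suc.prems by (metis Suc_n_not_le_n enat_ord_simps(1) nle_le order_trans)
  then show ?case using Suc component_level[of "Suc n" u] by simp
qed

text \<open>Supplies the coefficient condition of \<open>orthogonal_has_sum\<close>. A component at
  level \<open>n\<close> lies in \<open>V n\<close>, so \<open>u\<close> may be replaced by
  \<open>P n u\<close>, which is the component plus a vector orthogonal to it.\<close>

lemma ip_component:
  assumes "k \<in> {1..q + 1}"
  shows "ip (component u k) u = ip (component u k) (component u k)"
  using assms
proof (cases rule: index_cases)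
  case (level n)
  have "component u k \<in> V n" using component_in_S[OF assms] S_subset_V level by blast
  from orth_residual[OF level(2,3) this, of u]
  have eq: "ip (component u k) u = ip (component u k) (P n u)" by (simp add: ip_right)
  show ?thesis
  proof (cases "n = 1")
    case True
    then show ?thesis using eq level component_1 by simp
  next
    case False
    then have n: "2 \<le> n" "1 \<le> n - 1" using level(2) by auto
    have le: "enat (n - 1) \<le> q"
      using level(3) by (metis diff_le_self enat_ord_simps(1) order_trans)
    have "component u k \<in> orth_complement_in ip (V (n - 1)) (V n)"
      using component_in_S[OF assms] level n(1) by (simp add: S_level W_space_orth_complement)
    then have "ip (P (n - 1) u) (component u k) = 0"
      using P_in_V[OF n(2) le] by (auto simp: orth_complement_in_def)
    moreover have "component u k = P n u - P (n - 1) u" using level n(1) by (simp add: component_level)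
    ultimately show ?thesis using eq by (metis diff_zero ip_commute ip_right(3))
  qed
next
  case top
  have "ip (u_approx I \<phi> q u) (component u k) = 0"
    unfolding top component_top by (intro orth_residual_top u_approx_in_V_top)
  then show ?thesis
    unfolding top component_top by (metis diff_zero ip_commute ip_right(3))
qed

lemma component_decomposes: "decomposes_as {1..q + 1} S u (component u)"
  unfolding decomposes_as_def
proof (intro conjI ballI)
  show "(component u has_sum u) {1..q + 1}"
  proof (rule orthogonal_has_sum)
    fix e :: real assume "e > 0"
    then obtain N where N: "1 \<le> N" "enat N \<le> q" "norm (u_approx I \<phi> q u - P N u) < e"
      using u_approx_approximable by blast
    have le: "enat k \<le> q" if "k \<le> N" for k
      using N(2) that by (metis enat_ord_simps(1) order_trans)
    \<comment> \<open>Including the top index makes the residual equal to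
      \<open>u_approx I \<phi> q u - P N u\<close>, which is small by the choice of
      \<open>N\<close>.\<close>
    let ?F = "insert (q + 1) (enat ` {1..N})"
    have "q + 1 \<notin> enat ` {1..N}"
    proof
      assume "q + 1 \<in> enat ` {1..N}"
      then obtain k where "q + 1 = enat k" "k \<in> {1..N}" by (rule imageE)
      moreover have "enat k \<noteq> q + 1" using calculation(2) by (intro level_neq_top le) simp
      ultimately show False by simp
    qed
    then have "sum (component u) ?F = component u (q + 1) + sum (component u) (enat ` {1..N})"
      by simp
    also have "sum (component u) (enat ` {1..N}) = P N u"
      by (subst sum.reindex) (simp_all add: inj_on_def sum_component[OF N(1,2), simplified])
    finally have "norm (u - sum (component u) ?F) < e" using N(3) by (simp add: component_top)
    moreover have "?F \<subseteq> {1..q + 1}"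
    proof -
      have "enat k \<in> {1..q + 1}" if "k \<in> {1..N}" for k
        using that by (intro level_in_index le) simp_all
      moreover have "q + 1 \<in> {1..q + 1}" by (simp add: add_increasing)
      ultimately show ?thesis by (intro insert_subsetI image_subsetI)
    qed
    ultimately show "\<exists>F. finite F \<and> F \<subseteq> {1..q + 1} \<and> norm (u - sum (component u) F) < e"
      by (intro exI[of _ ?F] conjI) simp_all
  next
    fix k l assume "k \<in> {1..q + 1}" "l \<in> {1..q + 1}" "k \<noteq> l"
    then show "ip (component u k) (component u l) = 0" using S_orth component_in_S by blast
  qed (rule ip_component)
qed (rule component_in_S)

lemma S_orth_direct_sum: "is_orth_direct_sum ip {1..q + 1} S UNIV"
  unfolding is_orth_direct_sum_def
proof (intro conjI ballI allI impI)
  show "UNIV = {u. \<exists>f. decomposes_as {1..q + 1} S u f}" using component_decomposes by blast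
next
  fix u f g k
  assume "decomposes_as {1..q + 1} S u f" "decomposes_as {1..q + 1} S u g" "k \<in> {1..q + 1}"
  then show "f k = g k"
    using orthogonal_decomposition_unique[of "{1..q + 1}" S u f g k] S_orth subspace_S by blast
next
  fix k l x y
  assume "k \<in> {1..q + 1}" "l \<in> {1..q + 1}" "k \<noteq> l" "x \<in> S k" "y \<in> S l"
  then show "ip x y = 0" by (rule S_orth)
qed (rule subspace_S)

end

text \<open>For finite depth, independence descends from the finest level, one full-rank matrix at a
  time; for infinite depth there is no finest level and \<open>indep\<close> covers each
  level.\<close>

lemma lin_indep_levels:
  assumes tree: "index_tree q I"
    and rank: "\<And>k. 1 \<le> k \<Longrightarrow> enat k < q \<Longrightarrow>
      mat_rank (level I k) (level I (k + 1)) (\<pi> k) = card (level I k)"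
    and indep: "case q of
        enat n \<Rightarrow> lin_indep_family (\<phi> n) (level I n)
      | \<infinity> \<Rightarrow> (\<forall>k\<ge>1. lin_indep_family (\<phi> k) (level I k))"
    and nesting: "\<And>k i. 1 \<le> k \<Longrightarrow> enat k < q \<Longrightarrow> i \<in> level I k \<Longrightarrow>
      \<phi> k i = (\<Sum>j\<in>level I (k + 1). \<pi> k i j *\<^sub>R \<phi> (k + 1) j)"
    and k: "1 \<le> k" "enat k \<le> q"
  shows "lin_indep_family (\<phi> k) (level I k)"
proof (cases q)
  case (enat n)
  then have "k \<le> n" using k(2) by simp
  then show ?thesis
  proof (induction k rule: inc_induct)
    case base
    then show ?case using indep enat by simp
  next
    case (step m)
    have m: "1 \<le> m" "enat m < q" using step k(1) enat by auto
    then have "finite (level I m)" "finite (level I (m + 1))"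
      using tree step enat by (auto simp: index_tree_def)
    then show ?case
      using rank[OF m] _ nesting[OF m] by (rule lin_indep_family_full_rank) (use step in simp)
  qed
next
  case infinity
  then show ?thesis using indep k(1) by simp
qed

text \<open>Convergence is stated separately because \<open>lim\<close> denotes a limit only for
  convergent sequences. The inclusion is stated because \<open>orth_complement_in\<close> does not
  force its first space into its second.\<close>

theorem theorem3p16:
  fixes Q :: "('b::banach \<Rightarrow>\<^sub>L real) \<Rightarrow> 'b"
    and q :: enat
    and I :: "'l tuple set"
    and \<pi> :: "nat \<Rightarrow> 'l tuple \<Rightarrow> 'l tuple \<Rightarrow> real"
    and \<phi> :: "nat \<Rightarrow> 'l tuple \<Rightarrow> ('b \<Rightarrow>\<^sub>L real)"
    and J :: "nat \<Rightarrow> 'l tuple set"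
    and W :: "nat \<Rightarrow> 'l tuple \<Rightarrow> 'l tuple \<Rightarrow> real"
  assumes reflexive: "reflexive_space TYPE('b)"
    and separable: "separable_space (euclidean :: 'b topology)"
    and Q: "sym_pos_bijection Q"
    and quadratic: "quadratic_norm Q"
    and depth: "1 \<le> q"
    and tree: "index_tree q I"
    and rank: "\<And>k. 1 \<le> k \<Longrightarrow> enat k < q \<Longrightarrow>
      mat_rank (level I k) (level I (k + 1)) (\<pi> k) = card (level I k)"
    and indep: "case q of
        enat n \<Rightarrow> lin_indep_family (\<phi> n) (level I n)
      | \<infinity> \<Rightarrow> (\<forall>k\<ge>1. lin_indep_family (\<phi> k) (level I k))"
    and nesting: "\<And>k i. 1 \<le> k \<Longrightarrow> enat k < q \<Longrightarrow> i \<in> level I k \<Longrightarrow>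
      \<phi> k i = (\<Sum>j\<in>level I (k + 1). \<pi> k i j *\<^sub>R \<phi> (k + 1) j)"
    and J: "\<And>k. 2 \<le> k \<Longrightarrow> enat k \<le> q \<Longrightarrow> wavelet_index_set I k (J k)"
    and W: "\<And>k. 2 \<le> k \<Longrightarrow> enat k \<le> q \<Longrightarrow>
      mat_image (level I k) (J k) (mat_transpose (W k)) =
      mat_kernel (level I (k - 1)) (level I k) (\<pi> (k - 1))"
  shows "(\<forall>k. 2 \<le> k \<and> enat k \<le> q \<longrightarrow>
            V_space I \<phi> (enat (k - 1)) \<subseteq> V_space I \<phi> (enat k) \<and>
            W_space I \<phi> J W k =
              orth_complement_in (scalar_prod Q)
                (V_space I \<phi> (enat (k - 1))) (V_space I \<phi> (enat k)))
       \<and> is_orth_direct_sum (scalar_prod Q) {1..q + 1} (summand_space Q q I \<phi> J W) UNIV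
       \<and> (q = \<infinity> \<longrightarrow> (\<forall>u. convergent (\<lambda>k. u_level I \<phi> k u)))
       \<and> (\<forall>u. decomposes_as {1..q + 1} (summand_space Q q I \<phi> J W) u (u_component q I \<phi> u))"
proof -
  have fin: "finite (level I k)" if "1 \<le> k" "enat k \<le> q" for k
    using tree that by (simp add: index_tree_def)
  interpret gamblet_tree Q q I \<pi> \<phi> J W
  proof (intro gamblet_tree.intro quadratic_banach.intro gamblet_tree_axioms.intro)
    show "lin_indep_family (\<phi> k) (level I k)" if "1 \<le> k" "enat k \<le> q" for k
      using tree rank indep nesting that by (rule lin_indep_levels)
    show "finite (J k)" if "2 \<le> k" "enat k \<le> q" for k
      using J[OF that] by (simp add: wavelet_index_set_def)
  qed (fact Q quadratic depth fin nesting W)+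
  have "V_space I \<phi> (enat (k - 1)) \<subseteq> V_space I \<phi> (enat k)" if "2 \<le> k" "enat k \<le> q" for k
    using that by (intro V_mono) auto
  then show ?thesis
    using W_space_orth_complement S_orth_direct_sum convergent_P component_decomposes by blast
qed

end
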